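(* Let $r\ge1$ be an integer, let $\mathcal{D}\subseteq\mathbb{R}^n$ be open, let $h\colon\mathcal{D}\to\mathbb{R}$ be $r$-times continuously differentiable, and let the system vector field $f\colon\mathcal{D}\to\mathbb{R}^n$ (locally Lipschitz) be $(r-1)$-times continuously differentiable. Define $$f^{[0]}(x)\triangleq x,\qquad f^{[j]}(x)\triangleq\nabla f^{[j-1]}(x)\,f(x),\quad j\in\{1,\ldots,r\},$$ and the order-$r$ dual flow seed $$x_{\mathbb{D}_{(r)},f}\triangleq\sum_{j=0}^r\frac1{j!}f^{[j]}(x)\,\epsilon^j\in\mathbb{D}_{(r)}^n.$$ Then, for $x\in\mathcal{D}$, $$\tilde h\big(x_{\mathbb{D}_{(r)},f}\big)=\sum_{j=0}^r\frac1{j!}L_f^jh(x)\,\epsilon^j.$$ Specifically, for all $j\in\{0,\ldots,r\}$, $L_f^jh(x)=j!\,c_j$, where $c_j$ is the coefficient of $\epsilon^j$ in $\tilde h\big(x_{\mathbb{D}_{(r)},f}\big)$.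
   Context: The truncated polynomial dual ring of order $r$ is $\mathbb{D}_{(r)}\triangleq\mathbb{R}[\epsilon]/(\epsilon^{r+1})$; each element is uniquely $\sum_{j=0}^ra_j\epsilon^j$ with $a_j\in\mathbb{R}$. The dual extension of a $C^r$ function $\phi\colon\mathbb{R}\to\mathbb{R}$ to $\mathbb{D}_{(r)}$ is the truncated Taylor expansion $\tilde\phi(z)\triangleq\sum_{j=0}^r\frac{\phi^{(j)}(a_0)}{j!}(z-a_0)^j$, for $z=\sum_ka_k\epsilon^k$, computed in $\mathbb{D}_{(r)}$. Its multivariable form, for a $C^r$ function $h\colon\mathcal{D}\to\mathbb{R}$ and $z\in\mathbb{D}_{(r)}^n$ whose constant term is $x\in\mathcal{D}$, is $\tilde h(z)=\sum_{k=0}^r\frac1{k!}D^kh(x)[z-x]^k$, computed in $\mathbb{D}_{(r)}$, where $D^kh(x)$ is the symmetric $k$-th order derivative tensor and $D^kh(x)[w]^k\triangleq\sum_{i_1,\ldots,i_k=1}^n\frac{\partial^kh}{\partial x_{(i_1)}\cdots\partial x_{(i_k)}}(x)\,w_{(i_1)}\cdots w_{(i_k)}$. For a vector-valued map, $\nabla f^{[j-1]}$ denotes its Jacobian. Iterated Lie derivatives: $L_f^0h\triangleq h$, $L_f^jh\triangleq L_f(L_f^{j-1}h)$, with $L_f\eta(x)\triangleq\nabla\eta(x)f(x)$. *)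

theory Defs
  imports
    "HOL-Analysis.Analysis"
    "HOL-Algebra.QuotRing"
    "HOL-Computational_Algebra.Polynomial"
begin

subsection \<open>The truncated polynomial dual ring\<close>

text \<open>
  An element \<open>a\<^sub>0 + a\<^sub>1 \<epsilon> + \<dots> + a\<^sub>r \<epsilon>\<^sup>r\<close> of \<open>\<real>[\<epsilon>]/(\<epsilon>\<^sup>r\<^sup>+\<^sup>1)\<close> is encoded as its unique
  representative of degree at most \<open>r\<close>.  Sums and real multiples of representatives are again
  representatives, so in the ring they are the ordinary ones of \<^typ>\<open>real poly\<close>; only products
  have to be reduced.  Lemma \<open>dual_ring_iso\<close> below compares this with the quotient ring proper.
\<close>

definition dual_ring :: "nat \<Rightarrow> real poly ring" where
  "dual_ring r =
    \<lparr> carrier = {p. degree p \<le> r},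
      monoid.mult = (\<lambda>p q. (p * q) mod monom 1 (Suc r)),
      one = 1, zero = 0, add = (+) \<rparr>"

definition real_poly_ring :: "real poly ring" where
  "real_poly_ring = \<lparr> carrier = UNIV, monoid.mult = (*), one = 1, zero = 0, add = (+) \<rparr>"

lemma degree_mod_monom: "degree (p mod monom (1::real) (Suc r)) \<le> r"
  using degree_mod_less[of "monom (1::real) (Suc r)" p]
  by (auto simp: degree_monom_eq monom_eq_0_iff)

lemma mod_monom_id: "degree p \<le> r \<Longrightarrow> p mod monom (1::real) (Suc r) = p"
  by (simp add: mod_poly_less degree_monom_eq)

lemma cring_real_poly_ring: "cring real_poly_ring"
proof (rule cringI)
  show "abelian_group real_poly_ring"
    by (rule abelian_groupI)
      (auto simp: real_poly_ring_def algebra_simps intro: exI[of _ "- _"])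
  show "comm_monoid real_poly_ring"
    by (rule comm_monoidI) (auto simp: real_poly_ring_def algebra_simps)
qed (auto simp: real_poly_ring_def algebra_simps)

lemma cring_dual_ring: "cring (dual_ring r)"
proof (rule cringI)
  show "abelian_group (dual_ring r)"
  proof (rule abelian_groupI)
    fix p assume "p \<in> carrier (dual_ring r)"
    then show "\<exists>q\<in>carrier (dual_ring r). q \<oplus>\<^bsub>dual_ring r\<^esub> p = \<zero>\<^bsub>dual_ring r\<^esub>"
      by (intro bexI[of _ "- p"]) (auto simp: dual_ring_def)
  qed (auto simp: dual_ring_def algebra_simps intro: degree_add_le)
  show "comm_monoid (dual_ring r)"
  proof (rule comm_monoidI)
    fix p q s :: "real poly"
    have "(p * q mod monom 1 (Suc r)) * s mod monom 1 (Suc r) =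
        p * (q * s mod monom 1 (Suc r)) mod monom 1 (Suc r)"
      by (simp only: mod_mult_left_eq mod_mult_right_eq mult.assoc)
    then show "p \<otimes>\<^bsub>dual_ring r\<^esub> q \<otimes>\<^bsub>dual_ring r\<^esub> s =
        p \<otimes>\<^bsub>dual_ring r\<^esub> (q \<otimes>\<^bsub>dual_ring r\<^esub> s)"
      by (simp add: dual_ring_def)
  qed (auto simp: dual_ring_def degree_mod_monom mod_monom_id mult.commute)
next
  fix p q s
  show "(p \<oplus>\<^bsub>dual_ring r\<^esub> q) \<otimes>\<^bsub>dual_ring r\<^esub> s =
      p \<otimes>\<^bsub>dual_ring r\<^esub> s \<oplus>\<^bsub>dual_ring r\<^esub> q \<otimes>\<^bsub>dual_ring r\<^esub> s"
    by (simp add: dual_ring_def distrib_right poly_mod_add_left)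
qed

lemma dual_ring_proj_hom:
  "ring_hom_ring real_poly_ring (dual_ring r) (\<lambda>p. p mod monom 1 (Suc r))"
proof (rule ring_hom_ringI2)
  show "ring real_poly_ring"
    by (rule cring.axioms(1)[OF cring_real_poly_ring])
  show "ring (dual_ring r)"
    by (rule cring.axioms(1)[OF cring_dual_ring])
  show "(\<lambda>p. p mod monom 1 (Suc r)) \<in> ring_hom real_poly_ring (dual_ring r)"
    by (rule ring_hom_memI)
      (simp_all add: real_poly_ring_def dual_ring_def degree_mod_monom mod_monom_id mod_mult_eq
         poly_mod_add_left)
qed

lemma dual_ring_iso:
  "real_poly_ring Quot {p. monom 1 (Suc r) dvd p} \<simeq> dual_ring r"
proof -
  let ?proj = "\<lambda>p::real poly. p mod monom 1 (Suc r)"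
  have "a_kernel real_poly_ring (dual_ring r) ?proj = {p. monom 1 (Suc r) dvd p}"
    by (simp add: a_kernel_def' real_poly_ring_def dual_ring_def mod_eq_0_iff_dvd)
  moreover have "?proj ` carrier real_poly_ring = carrier (dual_ring r)"
  proof
    show "?proj ` carrier real_poly_ring \<subseteq> carrier (dual_ring r)"
      by (simp add: image_subset_iff dual_ring_def degree_mod_monom)
    show "carrier (dual_ring r) \<subseteq> ?proj ` carrier real_poly_ring"
    proof
      fix p assume "p \<in> carrier (dual_ring r)"
      then have "p = ?proj p"
        by (simp add: dual_ring_def mod_monom_id)
      then show "p \<in> ?proj ` carrier real_poly_ring"
        by (rule image_eqI) (simp add: real_poly_ring_def)
    qed
  qed
  ultimately show ?thesis
    using ring_hom_ring.FactRing_iso[OF dual_ring_proj_hom] by metis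
qed

subsection \<open>Derivatives\<close>

text \<open>For open \<open>S\<close>: the Frechet derivatives up to order \<open>k\<close> exist and are continuous on \<open>S\<close>
  (a continuous operator-valued map is expressed by its values at each fixed direction \<open>v\<close>,
  which is the same because the spaces used here are finite-dimensional).\<close>

primrec times_cont_diff_on ::
  "nat \<Rightarrow> 'a::euclidean_space set \<Rightarrow> ('a \<Rightarrow> 'b::real_normed_vector) \<Rightarrow> bool" where
  "times_cont_diff_on 0 S g \<longleftrightarrow> continuous_on S g"
| "times_cont_diff_on (Suc k) S g \<longleftrightarrow>
    (\<forall>x\<in>S. g differentiable (at x)) \<and>
    (\<forall>v. times_cont_diff_on k S (\<lambda>x. frechet_derivative g (at x) v))"

definition partial_deriv :: "'n::finite \<Rightarrow> (real^'n \<Rightarrow> real) \<Rightarrow> real^'n \<Rightarrow> real" where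
  "partial_deriv i g x = deriv (\<lambda>t. g (x + t *\<^sub>R axis i 1)) 0"

primrec partial_derivs :: "'n::finite list \<Rightarrow> (real^'n \<Rightarrow> real) \<Rightarrow> real^'n \<Rightarrow> real" where
  "partial_derivs [] g = g"
| "partial_derivs (i # is) g = partial_deriv i (partial_derivs is g)"

definition gradient :: "(real^'n \<Rightarrow> real) \<Rightarrow> real^'n \<Rightarrow> real^'n" where
  "gradient g x = (\<chi> i. partial_deriv i g x)"

primrec lie_deriv :: "(real^'n \<Rightarrow> real^'n) \<Rightarrow> nat \<Rightarrow> (real^'n \<Rightarrow> real) \<Rightarrow> real^'n \<Rightarrow> real" where
  "lie_deriv f 0 h = h"
| "lie_deriv f (Suc j) h = (\<lambda>x. gradient (lie_deriv f j h) x \<bullet> f x)"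

primrec flow_deriv :: "(real^'n \<Rightarrow> real^'n) \<Rightarrow> nat \<Rightarrow> real^'n \<Rightarrow> real^'n" where
  "flow_deriv f 0 = (\<lambda>x. x)"
| "flow_deriv f (Suc j) = (\<lambda>x. jacobian (flow_deriv f j) (at x) *v f x)"

subsection \<open>Dual extension and dual flow seed\<close>

definition dual_const :: "real poly ^ 'n \<Rightarrow> real ^ 'n" where
  "dual_const z = (\<chi> i. coeff (z $ i) 0)"

text \<open>\<open>D\<^sup>k h(x)[w]\<^sup>k\<close>: the multi-indices \<open>(i\<^sub>1, \<dots>, i\<^sub>k)\<close> are the lists of length \<open>k\<close>.\<close>

definition dual_deriv_form ::
  "nat \<Rightarrow> nat \<Rightarrow> (real^'n::finite \<Rightarrow> real) \<Rightarrow> real^'n \<Rightarrow> real poly ^ 'n \<Rightarrow> real poly" where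
  "dual_deriv_form r k h x w =
    (\<Sum>is | length is = k.
       smult (partial_derivs is h x)
         (foldr (\<lambda>i p. w $ i \<otimes>\<^bsub>dual_ring r\<^esub> p) is \<one>\<^bsub>dual_ring r\<^esub>))"

definition dual_ext :: "nat \<Rightarrow> (real^'n::finite \<Rightarrow> real) \<Rightarrow> real poly ^ 'n \<Rightarrow> real poly" where
  "dual_ext r h z =
    (let x = dual_const z in
     \<Sum>k\<le>r. smult (1 / fact k) (dual_deriv_form r k h x (\<chi> i. z $ i - [:x $ i:])))"

definition dual_seed :: "nat \<Rightarrow> (real^'n \<Rightarrow> real^'n) \<Rightarrow> real^'n \<Rightarrow> real poly ^ 'n" where
  "dual_seed r f x = (\<chi> i. \<Sum>j\<le>r. monom (1 / fact j * flow_deriv f j x $ i) j)"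

end

theory Submission
  imports Defs
begin

text \<open>
  Write the flow seed as \<open>x + w(x)\<close>; its coefficients satisfy \<open>L\<^sub>f w = w' - f\<close> modulo
  \<open>\<epsilon>\<^sup>r\<close>, where \<open>w'\<close> is the derivative in \<open>\<epsilon>\<close>.  By the product rule and the symmetry of the
  derivative tensors, applying \<open>L\<^sub>f\<close> to \<open>\<Sum>\<^sub>k D\<^sup>k h(x)[w]\<^sup>k / k!\<close> yields its derivative in
  \<open>\<epsilon>\<close> modulo \<open>\<epsilon>\<^sup>r\<close>, because the terms containing \<open>f\<close> telescope.  Hence the coefficients
  satisfy \<open>L\<^sub>f c\<^sub>j = (j + 1) c\<^sub>j\<^sub>+\<^sub>1\<close> for \<open>j < r\<close>, and \<open>c\<^sub>0 = h\<close>.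
\<close>

subsection \<open>Continuously differentiable maps\<close>

text \<open>As \<open>S\<close> is open, agreement on \<open>S\<close> is agreement near each of its
  points, so it passes to the derivatives and, by induction, to every order.\<close>

lemma times_cont_diff_on_cong:
  assumes "open S" "\<And>x. x \<in> S \<Longrightarrow> g x = g' x" "times_cont_diff_on k S g"
  shows "times_cont_diff_on k S g'"
  using assms(2,3)
proof (induction k arbitrary: g g')
  case 0
  then show ?case by (auto simp: continuous_on_eq)
next
  case (Suc k)
  have d: "g differentiable (at x)" if "x \<in> S" for x
    using Suc.prems that by auto
  have "g' differentiable (at x)" if "x \<in> S" for x
    using d[OF that] Suc.prems(1) assms(1) that
    by (meson differentiable_def has_derivative_transform_within_open)
  moreover have "times_cont_diff_on k S (\<lambda>x. frechet_derivative g' (at x) v)" for v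
  proof (rule Suc.IH)
    show "frechet_derivative g (at x) v = frechet_derivative g' (at x) v" if "x \<in> S" for x
      using frechet_derivative_transform_within_open[OF d[OF that] assms(1) that Suc.prems(1)]
      by simp
    show "times_cont_diff_on k S (\<lambda>x. frechet_derivative g (at x) v)"
      using Suc.prems by simp
  qed
  ultimately show ?case by simp
qed

text \<open>Uniqueness of the derivative permits an explicit formula \<open>G\<close> in place of
  \<open>frechet_derivative\<close>; the closure properties below are proved in this form.\<close>

lemma times_cont_diff_on_SucI:
  assumes "open S" "\<And>x. x \<in> S \<Longrightarrow> (g has_derivative G x) (at x)"
    and "\<And>v. times_cont_diff_on k S (\<lambda>x. G x v)"
  shows "times_cont_diff_on (Suc k) S g"
proof -
  have "times_cont_diff_on k S (\<lambda>x. frechet_derivative g (at x) v)" for v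
  proof (rule times_cont_diff_on_cong[OF assms(1) _ assms(3)[of v]])
    show "G x v = frechet_derivative g (at x) v" if "x \<in> S" for x
      using frechet_derivative_at[OF assms(2)[OF that]] by simp
  qed
  then show ?thesis
    using assms(2) by (auto simp: differentiable_def)
qed

lemma times_cont_diff_on_has_derivative:
  assumes "times_cont_diff_on (Suc k) S g" "x \<in> S"
  shows "(g has_derivative frechet_derivative g (at x)) (at x)"
  using assms by (simp add: frechet_derivative_works)

lemma times_cont_diff_on_SucD: "times_cont_diff_on (Suc k) S g \<Longrightarrow> times_cont_diff_on k S g"
proof (induction k arbitrary: g)
  case 0
  then show ?case
    by (auto simp: continuous_on_eq_continuous_within intro!: differentiable_imp_continuous_within
        dest: differentiable_at_withinI)
next
  case (Suc k)
  then show ?case by simp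
qed

lemma times_cont_diff_on_mono:
  assumes "times_cont_diff_on k S g" "j \<le> k"
  shows "times_cont_diff_on j S g"
  using assms(2,1) by (induction rule: inc_induct)
    (auto intro: times_cont_diff_on_SucD simp del: times_cont_diff_on.simps)

lemma times_cont_diff_on_const:
  assumes "open S"
  shows "times_cont_diff_on k S (\<lambda>x. c)"
proof (induction k arbitrary: c)
  case (Suc k)
  show ?case
    by (rule times_cont_diff_on_SucI[OF assms _ Suc]) (rule has_derivative_const)
qed simp

lemma times_cont_diff_on_bounded_linear:
  assumes "open S" "bounded_linear L" "times_cont_diff_on k S g"
  shows "times_cont_diff_on k S (\<lambda>x. L (g x))"
  using assms(3)
proof (induction k arbitrary: g)
  case 0
  then show ?case
    using assms(2) by (simp add: bounded_linear.continuous_on)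
next
  case (Suc k)
  show ?case
  proof (rule times_cont_diff_on_SucI[OF assms(1)])
    show "((\<lambda>x. L (g x)) has_derivative (\<lambda>v. L (frechet_derivative g (at x) v))) (at x)"
      if "x \<in> S" for x
      using times_cont_diff_on_has_derivative[OF Suc.prems that]
      by (rule bounded_linear.has_derivative[OF assms(2)])
    show "times_cont_diff_on k S (\<lambda>x. L (frechet_derivative g (at x) v))" for v
      using Suc by simp
  qed
qed

lemma times_cont_diff_on_add:
  assumes "open S" "times_cont_diff_on k S g" "times_cont_diff_on k S h"
  shows "times_cont_diff_on k S (\<lambda>x. g x + h x)"
  using assms(2,3)
proof (induction k arbitrary: g h)
  case 0
  then show ?case by (simp add: continuous_on_add)
next
  case (Suc k)
  show ?case
  proof (rule times_cont_diff_on_SucI[OF assms(1)])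
    show "((\<lambda>x. g x + h x) has_derivative
        (\<lambda>v. frechet_derivative g (at x) v + frechet_derivative h (at x) v)) (at x)"
      if "x \<in> S" for x
      using Suc.prems that
      by (intro has_derivative_add times_cont_diff_on_has_derivative)
    show "times_cont_diff_on k S (\<lambda>x. frechet_derivative g (at x) v + frechet_derivative h (at x) v)"
      for v
      using Suc by simp
  qed
qed

lemma times_cont_diff_on_sum:
  assumes "open S" "\<And>i. i \<in> I \<Longrightarrow> times_cont_diff_on k S (g i)"
  shows "times_cont_diff_on k S (\<lambda>x. \<Sum>i\<in>I. g i x)"
  using assms(2)
  by (induction I rule: infinite_finite_induct)
    (auto intro: times_cont_diff_on_const times_cont_diff_on_add assms(1))

lemma times_cont_diff_on_scaleR:
  assumes "open S" "times_cont_diff_on k S u" "times_cont_diff_on k S g"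
  shows "times_cont_diff_on k S (\<lambda>x. u x *\<^sub>R g x)"
  using assms(2,3)
proof (induction k arbitrary: u g)
  case 0
  then show ?case by (simp add: continuous_on_scaleR)
next
  case (Suc k)
  show ?case
  proof (rule times_cont_diff_on_SucI[OF assms(1)])
    show "((\<lambda>x. u x *\<^sub>R g x) has_derivative
        (\<lambda>v. u x *\<^sub>R frechet_derivative g (at x) v + frechet_derivative u (at x) v *\<^sub>R g x)) (at x)"
      if "x \<in> S" for x
      using Suc.prems that
      by (intro has_derivative_scaleR times_cont_diff_on_has_derivative)
    \<comment> \<open>The product rule contains \<open>u\<close> and \<open>g\<close>
      undifferentiated, so their own order is first lowered from \<open>Suc k\<close> to
      \<open>k\<close>.\<close>
    show "times_cont_diff_on k S
        (\<lambda>x. u x *\<^sub>R frechet_derivative g (at x) v + frechet_derivative u (at x) v *\<^sub>R g x)" for v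
      using Suc.prems times_cont_diff_on_SucD[OF Suc.prems(1)] times_cont_diff_on_SucD[OF Suc.prems(2)]
      by (intro times_cont_diff_on_add[OF assms(1)] Suc.IH) auto
  qed
qed

text \<open>The definition controls the derivative in fixed directions only; expanding
  \<open>f x\<close> in the basis reduces the moving direction to those.\<close>

lemma times_cont_diff_on_derivative_along:
  fixes g :: "'a::euclidean_space \<Rightarrow> 'b::real_normed_vector"
  assumes "open S" "times_cont_diff_on (Suc k) S g" "times_cont_diff_on k S f"
  shows "times_cont_diff_on k S (\<lambda>x. frechet_derivative g (at x) (f x))"
proof (rule times_cont_diff_on_cong[OF assms(1)])
  show "times_cont_diff_on k S (\<lambda>x. \<Sum>b\<in>Basis. (f x \<bullet> b) *\<^sub>R frechet_derivative g (at x) b)"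
    using assms
    by (intro times_cont_diff_on_sum times_cont_diff_on_scaleR
        times_cont_diff_on_bounded_linear[where L = "\<lambda>x. x \<bullet> _"] bounded_linear_inner_left) auto
  show "(\<Sum>b\<in>Basis. (f x \<bullet> b) *\<^sub>R frechet_derivative g (at x) b) =
      frechet_derivative g (at x) (f x)" if "x \<in> S" for x
  proof -
    interpret linear "frechet_derivative g (at x)"
      using times_cont_diff_on_has_derivative[OF assms(2) that] by (rule has_derivative_linear)
    have "frechet_derivative g (at x) (f x) =
        frechet_derivative g (at x) (\<Sum>b\<in>Basis. (f x \<bullet> b) *\<^sub>R b)"
      by (simp add: euclidean_representation)
    then show ?thesis
      by (simp add: sum scaleR)
  qed
qed

subsection \<open>Symmetry of iterated partial derivatives\<close>

lemma has_real_derivative_along_line: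
  fixes g :: "'a::real_normed_vector \<Rightarrow> real"
  assumes "(g has_derivative g') (at (y + a *\<^sub>R w))"
  shows "((\<lambda>a. g (y + a *\<^sub>R w)) has_real_derivative g' w) (at a within T)"
proof -
  have "((\<lambda>a. g (y + a *\<^sub>R w)) has_derivative (\<lambda>h. g' (h *\<^sub>R w))) (at a within T)"
    by (rule has_derivative_compose[where g = g]) (use assms in \<open>auto intro!: derivative_eq_intros\<close>)
  moreover have "g' (h *\<^sub>R w) = h * g' w" for h
    using linear_cmul[OF has_derivative_linear[OF assms]] by simp
  ultimately show ?thesis by (simp add: has_field_derivative_def mult_commute_abs)
qed

text \<open>The mean value theorem is applied twice: in direction \<open>u\<close> to the difference
  over the step \<open>t\<close> in direction \<open>v\<close>, then in direction \<open>v\<close>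
  to the derivative along \<open>u\<close>. The hypothesis keeps the whole parallelogram inside
  \<open>S\<close>.\<close>

lemma second_difference_mvt:
  fixes g :: "'a::euclidean_space \<Rightarrow> real"
  assumes g: "times_cont_diff_on 2 S g" and "t > 0"
    and S: "\<And>a b. 0 \<le> a \<Longrightarrow> a \<le> t \<Longrightarrow> 0 \<le> b \<Longrightarrow> b \<le> t \<Longrightarrow> x + a *\<^sub>R u + b *\<^sub>R v \<in> S"
  obtains a b where "0 \<le> a" "a \<le> t" "0 \<le> b" "b \<le> t"
    and "g (x + t *\<^sub>R u + t *\<^sub>R v) - g (x + t *\<^sub>R u) - g (x + t *\<^sub>R v) + g x =
      t\<^sup>2 * frechet_derivative (\<lambda>z. frechet_derivative g (at z) u)
        (at (x + a *\<^sub>R u + b *\<^sub>R v)) v"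
proof -
  define g1 where "g1 = (\<lambda>z. frechet_derivative g (at z))"
  define g2 where "g2 = (\<lambda>z. frechet_derivative (\<lambda>z. g1 z u) (at z))"
  have g': "times_cont_diff_on (Suc (Suc 0)) S g"
    using g by (simp add: numeral_2_eq_2)
  have g1: "(g has_derivative g1 z) (at z)" if "z \<in> S" for z
    using times_cont_diff_on_has_derivative[OF g' that] by (simp add: g1_def)
  have g1u: "times_cont_diff_on (Suc 0) S (\<lambda>z. g1 z u)"
    using g' unfolding g1_def times_cont_diff_on.simps(2)[of "Suc 0"] by blast
  have g2: "((\<lambda>z. g1 z u) has_derivative g2 z) (at z)" if "z \<in> S" for z
    using times_cont_diff_on_has_derivative[OF g1u that] by (simp add: g2_def)
  \<comment> \<open>The second difference is the increment of \<open>\<phi>\<close> from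
    \<open>0\<close> to \<open>t\<close>.\<close>
  define \<phi> where "\<phi> = (\<lambda>a. g ((x + t *\<^sub>R v) + a *\<^sub>R u) - g (x + a *\<^sub>R u))"
  have "(\<phi> has_field_derivative (g1 ((x + t *\<^sub>R v) + a *\<^sub>R u) u - g1 (x + a *\<^sub>R u) u)) (at a)"
    if "0 \<le> a" "a \<le> t" for a
  proof -
    have "x + t *\<^sub>R v + a *\<^sub>R u \<in> S" "x + a *\<^sub>R u \<in> S"
      using S[of a t] S[of a 0] that \<open>t > 0\<close> by (simp_all add: algebra_simps)
    then show ?thesis
      unfolding \<phi>_def by (intro DERIV_diff has_real_derivative_along_line g1)
  qed
  from MVT2[OF \<open>t > 0\<close> this] obtain a where a: "0 < a" "a < t"
    and \<phi>: "\<phi> t - \<phi> 0 = t * (g1 ((x + t *\<^sub>R v) + a *\<^sub>R u) u - g1 (x + a *\<^sub>R u) u)"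
    by auto
  have "((\<lambda>b. g1 ((x + a *\<^sub>R u) + b *\<^sub>R v) u) has_field_derivative
      g2 ((x + a *\<^sub>R u) + b *\<^sub>R v) v) (at b)" if "0 \<le> b" "b \<le> t" for b
    using S[of a b] that a by (intro has_real_derivative_along_line g2) simp
  from MVT2[OF \<open>t > 0\<close> this] obtain b where b: "0 < b" "b < t"
    and \<psi>: "g1 ((x + a *\<^sub>R u) + t *\<^sub>R v) u - g1 (x + a *\<^sub>R u) u =
      t * g2 ((x + a *\<^sub>R u) + b *\<^sub>R v) v"
    by auto
  show ?thesis
  proof
    show "0 \<le> a" "a \<le> t" "0 \<le> b" "b \<le> t" using a b by auto
    have "g (x + t *\<^sub>R u + t *\<^sub>R v) - g (x + t *\<^sub>R u) - g (x + t *\<^sub>R v) + g x = \<phi> t - \<phi> 0"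
      by (simp add: \<phi>_def algebra_simps)
    also have "\<dots> = t * (t * g2 ((x + a *\<^sub>R u) + b *\<^sub>R v) v)"
      using \<phi> \<psi> by (simp add: algebra_simps)
    finally show "g (x + t *\<^sub>R u + t *\<^sub>R v) - g (x + t *\<^sub>R u) - g (x + t *\<^sub>R v) + g x =
      t\<^sup>2 * frechet_derivative (\<lambda>z. frechet_derivative g (at z) u)
        (at (x + a *\<^sub>R u + b *\<^sub>R v)) v"
      by (simp add: g2_def g1_def power2_eq_square)
  qed
qed

text \<open>Schwarz's theorem. The second difference is symmetric in \<open>u\<close> and
  \<open>v\<close>, so the two mixed derivatives coincide at suitable points arbitrarily near
  \<open>x\<close>, and continuity carries this to \<open>x\<close>.\<close>

lemma second_frechet_derivative_symmetric:
  fixes g :: "'a::euclidean_space \<Rightarrow> real"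
  assumes "open S" and g: "times_cont_diff_on 2 S g" and "x \<in> S"
  shows "frechet_derivative (\<lambda>z. frechet_derivative g (at z) u) (at x) v =
    frechet_derivative (\<lambda>z. frechet_derivative g (at z) v) (at x) u"
proof -
  define G where "G = (\<lambda>u v z. frechet_derivative (\<lambda>z. frechet_derivative g (at z) u) (at z) v)"
  have cont: "isCont (G u v) x" for u v
    using g assms(1,3) by (simp add: G_def numeral_2_eq_2 continuous_on_eq_continuous_at)
  have "\<bar>G u v x - G v u x\<bar> \<le> e" if "e > 0" for e
  proof -
    have "\<forall>\<^sub>F z in nhds x. z \<in> S \<and> dist (G u v z) (G u v x) < e / 2 \<and>
        dist (G v u z) (G v u x) < e / 2"
      using cont \<open>e > 0\<close> assms(1,3)
      by (intro eventually_conj tendstoD eventually_nhds_in_open)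
        (auto simp: isCont_def tendsto_nhds_iff)
    then obtain d where d: "d > 0" "\<And>z. dist z x < d \<Longrightarrow> z \<in> S \<and>
        dist (G u v z) (G u v x) < e / 2 \<and> dist (G v u z) (G v u x) < e / 2"
      unfolding eventually_nhds_metric by blast
    \<comment> \<open>This step keeps the parallelogram spanned by \<open>t *\<^sub>R u\<close> and
      \<open>t *\<^sub>R v\<close> within distance \<open>d\<close> of \<open>x\<close>; the summand
      1 makes the denominator positive and the bound strict.\<close>
    define t where "t = d / (norm u + norm v + 1)"
    have "t > 0"
      using d by (auto simp: t_def intro!: divide_pos_pos add_nonneg_pos)
    have near: "dist (x + a *\<^sub>R u + b *\<^sub>R v) x < d" if "0 \<le> a" "a \<le> t" "0 \<le> b" "b \<le> t" for a b
    proof -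
      have "norm (a *\<^sub>R u + b *\<^sub>R v) \<le> a * norm u + b * norm v"
        using norm_triangle_ineq[of "a *\<^sub>R u" "b *\<^sub>R v"] that by simp
      also have "\<dots> \<le> t * norm u + t * norm v"
        using that by (intro add_mono mult_right_mono) auto
      also have "\<dots> < t * (norm u + norm v + 1)"
        using \<open>t > 0\<close> by (simp add: algebra_simps)
      also have "\<dots> = d"
        using norm_ge_zero[of u] norm_ge_zero[of v] unfolding t_def
        by (simp add: add_nonneg_pos less_imp_neq[symmetric])
      finally show ?thesis by (simp add: dist_norm algebra_simps)
    qed
    have near': "dist (x + a *\<^sub>R v + b *\<^sub>R u) x < d" if "0 \<le> a" "a \<le> t" "0 \<le> b" "b \<le> t" for a b
      using near[OF that(3,4,1,2)] by (simp add: algebra_simps)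
    obtain a b where ab: "0 \<le> a" "a \<le> t" "0 \<le> b" "b \<le> t"
      "g (x + t *\<^sub>R u + t *\<^sub>R v) - g (x + t *\<^sub>R u) - g (x + t *\<^sub>R v) + g x =
        t\<^sup>2 * G u v (x + a *\<^sub>R u + b *\<^sub>R v)"
      using second_difference_mvt[OF g \<open>t > 0\<close>] near d(2) unfolding G_def by metis
    obtain a' b' where ab': "0 \<le> a'" "a' \<le> t" "0 \<le> b'" "b' \<le> t"
      "g (x + t *\<^sub>R v + t *\<^sub>R u) - g (x + t *\<^sub>R v) - g (x + t *\<^sub>R u) + g x =
        t\<^sup>2 * G v u (x + a' *\<^sub>R v + b' *\<^sub>R u)"
      using second_difference_mvt[OF g \<open>t > 0\<close>] near' d(2) unfolding G_def by metis
    have "t\<^sup>2 * G u v (x + a *\<^sub>R u + b *\<^sub>R v) = t\<^sup>2 * G v u (x + a' *\<^sub>R v + b' *\<^sub>R u)"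
      using ab(5) ab'(5) by (simp add: algebra_simps)
    then have "G u v (x + a *\<^sub>R u + b *\<^sub>R v) = G v u (x + a' *\<^sub>R v + b' *\<^sub>R u)"
      using \<open>t > 0\<close> by simp
    moreover have "dist (G u v (x + a *\<^sub>R u + b *\<^sub>R v)) (G u v x) < e / 2"
      using near[OF ab(1-4)] d(2) by blast
    moreover have "dist (G v u (x + a' *\<^sub>R v + b' *\<^sub>R u)) (G v u x) < e / 2"
      using near'[OF ab'(1-4)] d(2) by blast
    ultimately show ?thesis unfolding dist_real_def by linarith
  qed
  then have "\<bar>G u v x - G v u x\<bar> \<le> 0"
    by (rule field_le_epsilon) simp
  then show ?thesis by (simp add: G_def)
qed

section \<open>Partial derivatives in terms of Frechet derivatives\<close>

lemma partial_deriv_eq_has_derivative: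
  assumes "(g has_derivative g') (at x)"
  shows "partial_deriv i g x = g' (axis i 1)"
  unfolding partial_deriv_def
  by (intro DERIV_imp_deriv has_real_derivative_along_line) (use assms in simp)

lemma has_derivative_eq_sum_partial_deriv:
  fixes g :: "real^'n \<Rightarrow> real"
  assumes "(g has_derivative g') (at x)"
  shows "g' v = (\<Sum>i\<in>UNIV. v $ i * partial_deriv i g x)"
proof -
  interpret linear g' using assms by (rule has_derivative_linear)
  have "g' v = g' (\<Sum>i\<in>UNIV. (v $ i) *\<^sub>R axis i 1)"
    using basis_expansion[of v] by (simp add: scalar_mult_eq_scaleR)
  then show ?thesis
    by (simp add: sum scaleR partial_deriv_eq_has_derivative[OF assms])
qed

lemma gradient_inner_eq_has_derivative:
  assumes "(g has_derivative g') (at x)"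
  shows "gradient g x \<bullet> v = g' v"
  by (simp add: has_derivative_eq_sum_partial_deriv[OF assms] gradient_def inner_vec_def mult.commute)

lemma partial_derivs_append: "partial_derivs (xs @ ys) g = partial_derivs xs (partial_derivs ys g)"
  by (induction xs) auto

text \<open>For small \<open>t\<close> the point \<open>x + t *\<^sub>R axis i 1\<close> stays in
  the open set \<open>S\<close>, so each differentiation sees only values on
  \<open>S\<close>.\<close>

lemma partial_derivs_cong:
  assumes "open S" "\<And>z. z \<in> S \<Longrightarrow> g z = g' z" "x \<in> S"
  shows "partial_derivs is g x = partial_derivs is g' x"
  using assms(3)
proof (induction "is" arbitrary: x)
  case Nil
  then show ?case using assms(2) by simp
next
  case (Cons i "is")
  have "(\<lambda>t::real. x + t *\<^sub>R axis i 1) \<midarrow>0\<rightarrow> x"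
    by (auto intro!: tendsto_eq_intros)
  then have lim: "((\<lambda>t::real. x + t *\<^sub>R axis i 1) \<longlongrightarrow> x) (nhds 0)"
    by (simp add: tendsto_nhds_iff)
  have "\<forall>\<^sub>F t in nhds 0. x + t *\<^sub>R axis i 1 \<in> S"
    using topological_tendstoD[OF lim assms(1) Cons.prems] .
  then have "\<forall>\<^sub>F t in nhds 0. partial_derivs is g (x + t *\<^sub>R axis i 1) =
      partial_derivs is g' (x + t *\<^sub>R axis i 1)"
    by (rule eventually_mono) (rule Cons.IH)
  then show ?case
    unfolding partial_derivs.simps partial_deriv_def by (rule deriv_cong_ev) simp
qed

lemma times_cont_diff_on_partial_deriv:
  assumes "open S" "times_cont_diff_on (Suc k) S g"
  shows "times_cont_diff_on k S (partial_deriv i g)"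
proof (rule times_cont_diff_on_cong[OF assms(1)])
  show "times_cont_diff_on k S (\<lambda>x. frechet_derivative g (at x) (axis i 1))"
    using assms(2) by simp
  show "frechet_derivative g (at x) (axis i 1) = partial_deriv i g x" if "x \<in> S" for x
    using partial_deriv_eq_has_derivative[OF times_cont_diff_on_has_derivative[OF assms(2) that]]
    by simp
qed

lemma times_cont_diff_on_partial_derivs:
  assumes "open S" "times_cont_diff_on (length is + k) S g"
  shows "times_cont_diff_on k S (partial_derivs is g)"
  using assms(2)
proof (induction "is" arbitrary: k)
  case (Cons i "is")
  have "times_cont_diff_on (Suc k) S (partial_derivs is g)"
    using Cons.IH[of "Suc k"] Cons.prems by simp
  then show ?case
    using times_cont_diff_on_partial_deriv[OF assms(1)] by (simp only: partial_derivs.simps)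
qed simp

lemma partial_deriv_commute:
  assumes "open S" "times_cont_diff_on 2 S g" "x \<in> S"
  shows "partial_deriv i (partial_deriv j g) x = partial_deriv j (partial_deriv i g) x"
proof -
  have g': "times_cont_diff_on (Suc (Suc 0)) S g"
    using assms by (simp add: numeral_2_eq_2)
  \<comment> \<open>The inner partial derivative agrees with a Frechet derivative on
    \<open>S\<close> only, which suffices because \<open>S\<close> is open.\<close>
  have *: "partial_deriv i (partial_deriv j g) x =
      frechet_derivative (\<lambda>z. frechet_derivative g (at z) (axis j 1)) (at x) (axis i 1)" for i j
  proof -
    have "times_cont_diff_on (Suc 0) S (\<lambda>z. frechet_derivative g (at z) (axis j 1))"
      using g' unfolding times_cont_diff_on.simps(2)[of "Suc 0"] by blast
    note d = times_cont_diff_on_has_derivative[OF this assms(3)]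
    have "(partial_deriv j g has_derivative
        frechet_derivative (\<lambda>z. frechet_derivative g (at z) (axis j 1)) (at x)) (at x)"
      by (rule has_derivative_transform_within_open[OF d assms(1,3)])
        (metis partial_deriv_eq_has_derivative times_cont_diff_on_has_derivative[OF g'])
    then show ?thesis by (rule partial_deriv_eq_has_derivative)
  qed
  show ?thesis
    unfolding * by (rule second_frechet_derivative_symmetric[OF assms(1-3)])
qed

text \<open>The inner derivatives \<open>ys\<close> leave a twice continuously differentiable
  function, and the outer ones \<open>xs\<close> respect equality on \<open>S\<close>. Adjacent
  transpositions are the form of symmetry that \<open>sum_symmetric_leibniz_sum\<close> asks
  for.\<close>

lemma partial_derivs_swap:
  assumes "open S" "times_cont_diff_on k S g" "x \<in> S" "length xs + length ys + 2 \<le> k"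
  shows "partial_derivs (xs @ i # j # ys) g x = partial_derivs (xs @ j # i # ys) g x"
proof -
  have "times_cont_diff_on 2 S (partial_derivs ys g)"
    using assms by (intro times_cont_diff_on_partial_derivs times_cont_diff_on_mono[OF assms(2)]) auto
  from partial_deriv_commute[OF assms(1) this]
  show ?thesis
    unfolding partial_derivs_append by (intro partial_derivs_cong[OF assms(1) _ assms(3)]) simp
qed

subsection \<open>Flow derivatives\<close>

lemma flow_deriv_Suc:
  assumes "flow_deriv f j differentiable (at x)"
  shows "flow_deriv f (Suc j) x = frechet_derivative (flow_deriv f j) (at x) (f x)"
  using frechet_derivative_at[OF assms[unfolded jacobian_works]] by (simp add: fun_eq_iff)

text \<open>The shift to \<open>Suc j\<close> reflects that the first flow derivative is
  \<open>f\<close> itself, with no loss of order; each later one costs one order.\<close>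

lemma times_cont_diff_on_flow_deriv:
  fixes f :: "real^'n \<Rightarrow> real^'n"
  assumes "open S" "times_cont_diff_on (j + k) S f"
  shows "times_cont_diff_on k S (flow_deriv f (Suc j))"
  using assms(2)
proof (induction j arbitrary: k)
  case 0
  have "flow_deriv f (Suc 0) = f"
    using flow_deriv_Suc[of f 0] by (simp add: fun_eq_iff)
  then show ?case
    using 0 by (simp del: flow_deriv.simps)
next
  case (Suc j)
  have *: "times_cont_diff_on (Suc k) S (flow_deriv f (Suc j))"
    using Suc.IH[of "Suc k"] Suc.prems by simp
  then have "times_cont_diff_on k S (\<lambda>x. frechet_derivative (flow_deriv f (Suc j)) (at x) (f x))"
    using times_cont_diff_on_mono[OF Suc.prems]
    by (intro times_cont_diff_on_derivative_along[OF assms(1)]) auto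
  moreover have "flow_deriv f (Suc j) differentiable (at x)" if "x \<in> S" for x
    using * that by (simp del: flow_deriv.simps)
  ultimately show ?case
    by (intro times_cont_diff_on_cong[OF assms(1) flow_deriv_Suc[symmetric]])
qed

text \<open>For \<open>j = 0\<close> the map is the identity; otherwise it uses only
  \<open>j - 1\<close> derivatives of \<open>f\<close>, and at least one is left over. With
  \<open>k = r - 1\<close> this covers every \<open>j < r\<close>.\<close>

lemma flow_deriv_has_derivative:
  fixes f :: "real^'n \<Rightarrow> real^'n"
  assumes "open S" "times_cont_diff_on k S f" "j \<le> k" "x \<in> S"
  obtains F where "(flow_deriv f j has_derivative F) (at x)" "F (f x) = flow_deriv f (Suc j) x"
proof -
  have "flow_deriv f j differentiable (at x)"
  proof (cases j)
    case 0
    then show ?thesis by simp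
  next
    case (Suc i)
    have "times_cont_diff_on 1 S (flow_deriv f (Suc i))"
      using Suc assms(1,3)
      by (intro times_cont_diff_on_flow_deriv times_cont_diff_on_mono[OF assms(2)]) simp_all
    then show ?thesis
      using assms(4) Suc by (simp del: flow_deriv.simps)
  qed
  then show ?thesis
    using that flow_deriv_Suc by (metis frechet_derivative_works)
qed

subsection \<open>Polynomials modulo a power of the indeterminate\<close>

lemma coeff_mod_monom:
  "coeff (p mod monom (1::real) (Suc r)) j = (if j \<le> r then coeff p j else 0)"
proof (cases "j \<le> r")
  case True
  have "coeff p j = coeff (monom 1 (Suc r) * (p div monom 1 (Suc r)) + p mod monom 1 (Suc r)) j"
    by simp
  then show ?thesis
    using True unfolding coeff_add coeff_monom_mult by simp
next
  case False
  then show ?thesis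
    using degree_mod_monom[of p r] by (auto intro: coeff_eq_0)
qed

text \<open>Reduction is compatible with products, so it can be postponed to the end and the
  calculation carried out with ordinary polynomials.\<close>

lemma foldr_dual_mult:
  "foldr (\<lambda>i p. w i \<otimes>\<^bsub>dual_ring r\<^esub> p) is \<one>\<^bsub>dual_ring r\<^esub> =
    prod_list (map w is) mod monom 1 (Suc r)"
proof (induction "is")
  case Nil
  then show ?case by (simp add: dual_ring_def mod_monom_id)
next
  case (Cons i "is")
  then show ?case by (simp add: dual_ring_def mod_mult_right_eq)
qed

text \<open>Divisibility by \<open>monom 1 k\<close> expresses vanishing to order \<open>k\<close>
  in \<epsilon>; orders add up over the factors.\<close>

lemma monom_dvd_prod_list:
  assumes "\<And>i. monom (1::real) 1 dvd w i"
  shows "monom 1 (length is) dvd prod_list (map w is)"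
proof (induction "is")
  case (Cons i "is")
  then show ?case
    using mult_dvd_mono[OF assms[of i] Cons] by (simp add: mult_monom)
qed simp

section \<open>Sums over multi-indices and the Leibniz rule\<close>

lemma sum_length_Suc:
  "(\<Sum>is | length is = Suc k. F is) = (\<Sum>i\<in>UNIV. \<Sum>is | length is = k. F ((i::'a::finite) # is))"
proof -
  have "{is. length is = Suc k} = (\<lambda>(i, is). i # is) ` (UNIV \<times> {is :: 'a list. length is = k})"
    by (auto simp: length_Suc_conv)
  moreover have "inj_on (\<lambda>(i, is). i # is) (UNIV \<times> {is :: 'a list. length is = k})"
    by (auto simp: inj_on_def)
  ultimately show ?thesis
    by (simp add: sum.reindex sum.cartesian_product case_prod_unfold)
qed

text \<open>The value on the product of the \<open>w i\<close> of a derivation sending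
  \<open>w i\<close> to \<open>g i\<close>. Keeping \<open>g\<close> arbitrary serves the derivative
  in \<epsilon>, the derivative along \<open>f\<close>, and their difference.\<close>

primrec leibniz_sum :: "('i \<Rightarrow> 'a) \<Rightarrow> ('i \<Rightarrow> 'a) \<Rightarrow> 'i list \<Rightarrow> 'a::comm_ring_1" where
  "leibniz_sum g w [] = 0"
| "leibniz_sum g w (i # is) = g i * prod_list (map w is) + w i * leibniz_sum g w is"

lemma pderiv_sum: "pderiv (\<Sum>i\<in>I. p i) = (\<Sum>i\<in>I. pderiv (p i))"
  by (induction I rule: infinite_finite_induct) (auto simp: pderiv_add)

lemma pderiv_prod_list: "pderiv (prod_list (map w is)) = leibniz_sum (\<lambda>i. pderiv (w i)) w is"
  by (induction "is") (auto simp: pderiv_mult)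

lemma leibniz_sum_diff:
  "leibniz_sum (\<lambda>i. g i - g' i) w is = leibniz_sum g w is - leibniz_sum g' w is"
proof (induction "is")
  case (Cons i "is")
  show ?case by (simp add: Cons.IH algebra_simps)
qed simp

text \<open>The replacing factor vanishes at \<epsilon> = 0 as well, so no power of \<epsilon> is
  lost.\<close>

lemma monom_dvd_leibniz_sum:
  assumes "\<And>i. monom (1::real) 1 dvd w i" "\<And>i. monom 1 1 dvd g i"
  shows "monom 1 (length is) dvd leibniz_sum g w is"
proof (induction "is")
  case (Cons i "is")
  have "monom 1 1 * monom 1 (length is) dvd g i * prod_list (map w is)"
    by (intro mult_dvd_mono monom_dvd_prod_list assms)
  moreover have "monom 1 1 * monom 1 (length is) dvd w i * leibniz_sum g w is"
    by (intro mult_dvd_mono Cons assms)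
  ultimately show ?case
    by (simp add: mult_monom)
qed simp

text \<open>By symmetry of \<open>T\<close>, the factor \<open>g\<close> can be moved to the front
  from each of its \<open>Suc k\<close> positions, so all positions contribute equally.\<close>

lemma sum_symmetric_leibniz_sum:
  fixes w g :: "'i::finite \<Rightarrow> 'a::comm_ring_1 poly"
  assumes "\<And>xs i j ys. length xs + length ys + 2 = Suc k \<Longrightarrow> T (xs @ i # j # ys) = T (xs @ j # i # ys)"
  shows "(\<Sum>is | length is = Suc k. smult (T is) (leibniz_sum g w is)) =
    of_nat (Suc k) * (\<Sum>m\<in>UNIV. \<Sum>is | length is = k. smult (T (m # is)) (g m * prod_list (map w is)))"
  using assms
proof (induction k arbitrary: T)
  case 0
  then show ?case by (simp add: sum_length_Suc)
next
  case (Suc k)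
  define B where "B = (\<Sum>m\<in>UNIV. \<Sum>is | length is = Suc k. smult (T (m # is)) (g m * prod_list (map w is)))"
  have IH: "(\<Sum>is | length is = Suc k. smult (T (i # is)) (leibniz_sum g w is)) =
    of_nat (Suc k) * (\<Sum>m\<in>UNIV. \<Sum>is | length is = k. smult (T (i # m # is)) (g m * prod_list (map w is)))" for i
  proof (rule Suc.IH)
    fix xs ys :: "'i list" and a b
    assume "length xs + length ys + 2 = Suc k"
    then show "T (i # xs @ a # b # ys) = T (i # xs @ b # a # ys)"
      using Suc.prems[of "i # xs" ys a b] by simp
  qed
  \<comment> \<open>The induction hypothesis brings \<open>g\<close> to the second position;
    exchanging the first two indices brings it to the front.\<close>
  have "(\<Sum>i\<in>UNIV. w i * (\<Sum>m\<in>UNIV. \<Sum>is | length is = k.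
          smult (T (i # m # is)) (g m * prod_list (map w is)))) =
      (\<Sum>i\<in>UNIV. \<Sum>m\<in>UNIV. \<Sum>is | length is = k.
          smult (T (m # i # is)) (g m * prod_list (map w (i # is))))"
    using Suc.prems[of "[]"]
    by (auto simp: sum_distrib_left algebra_simps intro!: sum.cong)
  also have "\<dots> = B"
    unfolding B_def sum_length_Suc by (rule sum.swap)
  finally have B: "(\<Sum>i\<in>UNIV. w i * (\<Sum>m\<in>UNIV. \<Sum>is | length is = k.
          smult (T (i # m # is)) (g m * prod_list (map w is)))) = B" .
  \<comment> \<open>Either \<open>g\<close> already stands in front, which gives \<open>B\<close>,
    or it stands in the tail.\<close>
  have "(\<Sum>is | length is = Suc (Suc k). smult (T is) (leibniz_sum g w is)) =
      B + (\<Sum>i\<in>UNIV. w i * (\<Sum>is | length is = Suc k. smult (T (i # is)) (leibniz_sum g w is)))"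
    unfolding B_def sum_length_Suc[where k = "Suc k"]
    by (simp add: smult_add_right sum.distrib sum_distrib_left)
  also have "\<dots> = B + of_nat (Suc k) * B"
    unfolding IH B[symmetric] by (simp add: sum_distrib_left mult.left_commute)
  also have "\<dots> = of_nat (Suc (Suc k)) * B"
    by (simp add: algebra_simps)
  finally show ?case by (simp add: B_def)
qed

subsection \<open>Coefficientwise derivatives\<close>

text \<open>Directional derivative along \<open>v\<close> modulo \<epsilon>^\<open>r\<close>. The
  bound \<open>j < r\<close> is strict because the coefficient of order \<open>r\<close> in the seed
  is a multiple of \<open>flow_deriv f r\<close>, which may fail to be differentiable.\<close>

definition has_coeff_deriv ::
  "nat \<Rightarrow> 'a::real_normed_vector \<Rightarrow> ('a \<Rightarrow> real poly) \<Rightarrow> real poly \<Rightarrow> 'a \<Rightarrow> bool" where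
  "has_coeff_deriv r v P Q y \<longleftrightarrow>
    (\<forall>j<r. \<exists>F. ((\<lambda>y. coeff (P y) j) has_derivative F) (at y) \<and> F v = coeff Q j)"

lemma has_coeff_deriv_const: "has_coeff_deriv r v (\<lambda>y. p) 0 y"
  unfolding has_coeff_deriv_def by (auto intro!: exI[of _ "\<lambda>_. 0"])

lemma has_coeff_deriv_add:
  assumes "has_coeff_deriv r v P P' y" "has_coeff_deriv r v Q Q' y"
  shows "has_coeff_deriv r v (\<lambda>y. P y + Q y) (P' + Q') y"
  unfolding has_coeff_deriv_def
proof (intro allI impI)
  fix j assume "j < r"
  then obtain F G where "((\<lambda>y. coeff (P y) j) has_derivative F) (at y)" "F v = coeff P' j"
    "((\<lambda>y. coeff (Q y) j) has_derivative G) (at y)" "G v = coeff Q' j"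
    using assms unfolding has_coeff_deriv_def by blast
  then show "\<exists>F. ((\<lambda>y. coeff (P y + Q y) j) has_derivative F) (at y) \<and> F v = coeff (P' + Q') j"
    by (intro exI[of _ "\<lambda>h. F h + G h"]) simp
qed

lemma has_coeff_deriv_sum:
  assumes "\<And>i. i \<in> I \<Longrightarrow> has_coeff_deriv r v (P i) (Q i) y"
  shows "has_coeff_deriv r v (\<lambda>y. \<Sum>i\<in>I. P i y) (\<Sum>i\<in>I. Q i) y"
  unfolding has_coeff_deriv_def
proof (intro allI impI)
  fix j assume "j < r"
  then have "\<forall>i\<in>I. \<exists>F. ((\<lambda>y. coeff (P i y) j) has_derivative F) (at y) \<and> F v = coeff (Q i) j"
    using assms by (simp add: has_coeff_deriv_def)
  then obtain F where "\<forall>i\<in>I. ((\<lambda>y. coeff (P i y) j) has_derivative F i) (at y) \<and> F i v = coeff (Q i) j"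
    by metis
  then show "\<exists>F. ((\<lambda>y. coeff (\<Sum>i\<in>I. P i y) j) has_derivative F) (at y) \<and> F v = coeff (\<Sum>i\<in>I. Q i) j"
    by (intro exI[of _ "\<lambda>h. \<Sum>i\<in>I. F i h"]) (auto simp: coeff_sum intro!: has_derivative_sum)
qed

text \<open>Coefficient \<open>j\<close> of a product involves only coefficients up to
  \<open>j\<close>, so the restriction to orders below \<open>r\<close> is preserved.\<close>

lemma has_coeff_deriv_mult:
  assumes "has_coeff_deriv r v P P' y" "has_coeff_deriv r v Q Q' y"
  shows "has_coeff_deriv r v (\<lambda>y. P y * Q y) (P' * Q y + P y * Q') y"
  unfolding has_coeff_deriv_def
proof (intro allI impI)
  fix j assume "j < r"
  have "\<forall>i. \<exists>F. i \<le> j \<longrightarrow> ((\<lambda>y. coeff (P y) i) has_derivative F) (at y) \<and> F v = coeff P' i"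
    using assms(1) \<open>j < r\<close> by (auto simp: has_coeff_deriv_def)
  then obtain F where F: "\<And>i. i \<le> j \<Longrightarrow>
      ((\<lambda>y. coeff (P y) i) has_derivative F i) (at y) \<and> F i v = coeff P' i"
    by metis
  have "\<forall>i. \<exists>G. i \<le> j \<longrightarrow> ((\<lambda>y. coeff (Q y) i) has_derivative G) (at y) \<and> G v = coeff Q' i"
    using assms(2) \<open>j < r\<close> by (auto simp: has_coeff_deriv_def)
  then obtain G where G: "\<And>i. i \<le> j \<Longrightarrow>
      ((\<lambda>y. coeff (Q y) i) has_derivative G i) (at y) \<and> G i v = coeff Q' i"
    by metis
  have "((\<lambda>y. \<Sum>i\<le>j. coeff (P y) i * coeff (Q y) (j - i)) has_derivative
      (\<lambda>h. \<Sum>i\<le>j. coeff (P y) i * G (j - i) h + F i h * coeff (Q y) (j - i))) (at y)"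
    using F G by (intro has_derivative_sum has_derivative_mult) auto
  moreover have "(\<Sum>i\<le>j. coeff (P y) i * G (j - i) v + F i v * coeff (Q y) (j - i)) =
      coeff (P' * Q y + P y * Q') j"
    using F G by (simp add: coeff_mult sum.distrib)
  ultimately show "\<exists>F. ((\<lambda>y. coeff (P y * Q y) j) has_derivative F) (at y) \<and>
      F v = coeff (P' * Q y + P y * Q') j"
    unfolding coeff_mult by blast
qed

lemma has_coeff_deriv_smult:
  assumes "(u has_derivative u') (at y)" "has_coeff_deriv r v P P' y"
  shows "has_coeff_deriv r v (\<lambda>y. smult (u y) (P y)) (smult (u' v) (P y) + smult (u y) P') y"
proof -
  have "has_coeff_deriv r v (\<lambda>y. [:u y:]) [:u' v:] y"
    unfolding has_coeff_deriv_def
  proof (intro allI impI)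
    fix j
    have ex: "\<exists>F. ((\<lambda>y. 0) has_derivative F) (at y) \<and> F v = (0::real)"
      by (intro exI[of _ "\<lambda>_. 0"]) simp
    show "\<exists>F. ((\<lambda>y. coeff [:u y:] j) has_derivative F) (at y) \<and> F v = coeff [:u' v:] j"
      using assms(1) by (cases j) (auto intro: ex)
  qed
  from has_coeff_deriv_mult[OF this assms(2)] show ?thesis by simp
qed

lemma has_coeff_deriv_prod_list:
  assumes "\<And>i. has_coeff_deriv r v (w i) (w' i) y"
  shows "has_coeff_deriv r v (\<lambda>y. prod_list (map (\<lambda>i. w i y) is))
    (leibniz_sum w' (\<lambda>i. w i y) is) y"
proof (induction "is")
  case Nil
  then show ?case by (simp add: has_coeff_deriv_const)
next
  case (Cons i "is")
  then show ?case using has_coeff_deriv_mult[OF assms] by simp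
qed

text \<open>The coefficients below \<open>r\<close> vanish identically in \<open>y\<close>, however
  irregular the higher ones are.\<close>

lemma has_coeff_deriv_0:
  assumes "\<And>y. monom 1 r dvd P y"
  shows "has_coeff_deriv r v P 0 y"
proof -
  have "coeff (P y) j = 0" if "j < r" for j y
    using assms[of y] that by (simp add: monom_1_dvd_iff')
  then show ?thesis
    unfolding has_coeff_deriv_def by (auto intro!: exI[of _ "\<lambda>_. 0"])
qed

subsection \<open>The dual extension along the flow seed\<close>

text \<open>\<open>dual_form\<close> and \<open>taylor_poly\<close> are the unreduced counterparts
  of \<open>dual_deriv_form\<close> and \<open>dual_ext\<close>, to which \<open>pderiv\<close> and
  its product rule apply.\<close>

definition dual_form ::
  "nat \<Rightarrow> (real^'n::finite \<Rightarrow> real) \<Rightarrow> real^'n \<Rightarrow> ('n \<Rightarrow> real poly) \<Rightarrow> real poly" where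
  "dual_form k h x w = (\<Sum>is | length is = k. smult (partial_derivs is h x) (prod_list (map w is)))"

definition taylor_poly ::
  "nat \<Rightarrow> (real^'n::finite \<Rightarrow> real) \<Rightarrow> real^'n \<Rightarrow> ('n \<Rightarrow> real poly) \<Rightarrow> real poly" where
  "taylor_poly r h x w = (\<Sum>k\<le>r. smult (1 / fact k) (dual_form k h x w))"

definition seed_offset ::
  "nat \<Rightarrow> (real^'n \<Rightarrow> real^'n) \<Rightarrow> real^'n \<Rightarrow> 'n \<Rightarrow> real poly" where
  "seed_offset r f x i = dual_seed r f x $ i - [:x $ i:]"

section \<open>Coefficients of the dual extension and of the flow seed\<close>

lemma coeff_dual_ext:
  "coeff (dual_ext r h z) j =
    (if j \<le> r then coeff (taylor_poly r h (dual_const z) (\<lambda>i. z $ i - [:dual_const z $ i:])) j else 0)"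
  by (simp add: dual_ext_def dual_deriv_form_def taylor_poly_def dual_form_def foldr_dual_mult
      coeff_sum coeff_mod_monom Let_def)

lemma coeff_dual_seed:
  "coeff (dual_seed r f x $ i) j = (if j \<le> r then flow_deriv f j x $ i / fact j else 0)"
  by (simp add: dual_seed_def coeff_sum)

lemma coeff_seed_offset:
  "coeff (seed_offset r f x i) j =
    (if 0 < j \<and> j \<le> r then flow_deriv f j x $ i / fact j else 0)"
  by (cases j) (auto simp: seed_offset_def coeff_dual_seed)

lemma dual_const_seed: "dual_const (dual_seed r f x) = x"
  by (simp add: dual_const_def coeff_dual_seed)

lemma monom_dvd_seed_offset: "monom 1 1 dvd seed_offset r f x i"
  by (simp add: monom_1_dvd_iff' coeff_seed_offset)

lemma flow_deriv_1: "flow_deriv f (Suc 0) x = f x"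
  using flow_deriv_Suc[of f 0 x] by simp

text \<open>The constant term of the derivative is the first flow derivative, namely
  \<open>f\<close>; \<open>r \<ge> 1\<close> ensures that the seed contains it.\<close>

lemma monom_dvd_pderiv_seed_offset:
  assumes "r \<ge> 1"
  shows "monom 1 1 dvd pderiv (seed_offset r f x i) - [:f x $ i:]"
  using assms flow_deriv_1[of f x]
  by (simp add: monom_1_dvd_iff' coeff_pderiv coeff_seed_offset del: flow_deriv.simps)

text \<open>Differentiating \<open>flow_deriv f j\<close> along \<open>f\<close> gives
  \<open>flow_deriv f (Suc j)\<close>, and dividing by \<open>fact j\<close> yields
  \<open>Suc j\<close> times the next seed coefficient, as \<open>pderiv\<close> does.\<close>

lemma has_coeff_deriv_seed_offset:
  fixes f :: "real^'n \<Rightarrow> real^'n"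
  assumes "open S" "times_cont_diff_on (r - 1) S f" "x \<in> S"
  shows "has_coeff_deriv r (f x) (\<lambda>x. seed_offset r f x i)
    (pderiv (seed_offset r f x i) - [:f x $ i:]) x"
  unfolding has_coeff_deriv_def
proof (intro allI impI)
  fix j assume "j < r"
  show "\<exists>F. ((\<lambda>x. coeff (seed_offset r f x i) j) has_derivative F) (at x) \<and>
      F (f x) = coeff (pderiv (seed_offset r f x i) - [:f x $ i:]) j"
  proof (cases j)
    \<comment> \<open>The offset has no constant term, so both sides are zero: subtracting
      \<open>f\<close> removes the constant term of \<open>pderiv\<close>.\<close>
    case 0
    then show ?thesis
      using \<open>j < r\<close> flow_deriv_1[of f x]
      by (intro exI[of _ "\<lambda>_. 0"])
        (simp add: coeff_seed_offset coeff_pderiv del: flow_deriv.simps)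
  next
    case (Suc l)
    obtain F where F: "(flow_deriv f j has_derivative F) (at x)" "F (f x) = flow_deriv f (Suc j) x"
      using flow_deriv_has_derivative[OF assms(1,2) _ assms(3)] \<open>j < r\<close>
      by (metis One_nat_def Suc_pred less_Suc_eq_le less_nat_zero_code not_gr_zero)
    have "((\<lambda>x. flow_deriv f j x $ i / fact j) has_derivative (\<lambda>v. F v $ i / fact j)) (at x)"
      using bounded_linear.has_derivative[OF bounded_linear_vec_nth F(1)]
      by (rule bounded_linear.has_derivative[OF bounded_linear_divide])
    moreover have "F (f x) $ i / fact j = coeff (pderiv (seed_offset r f x i) - [:f x $ i:]) j"
      unfolding F(2) using Suc \<open>j < r\<close>
      by (simp add: coeff_seed_offset coeff_pderiv divide_simps del: flow_deriv.simps)
    ultimately show ?thesis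
      using Suc \<open>j < r\<close> by (auto simp: coeff_seed_offset simp del: flow_deriv.simps)
  qed
qed

section \<open>Differentiating the Taylor polynomial along the flow\<close>

lemma monom_dvd_dual_form:
  assumes "\<And>i. monom 1 1 dvd w i"
  shows "monom 1 k dvd dual_form k h x w"
  unfolding dual_form_def
  using monom_dvd_prod_list[OF assms] by (auto intro!: dvd_sum dvd_smult)

lemma coeff_0_taylor_poly:
  assumes "\<And>i. monom 1 1 dvd w i"
  shows "coeff (taylor_poly r h x w) 0 = h x"
proof -
  have "coeff (dual_form k h x w) 0 = (if k = 0 then h x else 0)" for k
    using monom_dvd_dual_form[OF assms, of k h x]
    by (cases k) (auto simp: monom_1_dvd_iff' dual_form_def)
  then show ?thesis
    by (simp add: taylor_poly_def coeff_sum if_distrib[of "(*) _"] cong: if_cong)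
qed

text \<open>Product rule. The tensor contributes the term of order \<open>Suc k\<close> with one
  entry \<open>v\<close>; the factors contribute \<open>pderiv (w x i) - [:v $ i:]\<close>, which
  splits linearly into the derivative in \<epsilon> and the subtracted sum.\<close>

lemma has_coeff_deriv_dual_form:
  fixes h :: "real^'n \<Rightarrow> real"
  assumes "open S" "times_cont_diff_on (Suc k) S h" "x \<in> S"
    and "\<And>i. has_coeff_deriv r v (\<lambda>x. w x i) (pderiv (w x i) - [:v $ i:]) x"
  shows "has_coeff_deriv r v (\<lambda>x. dual_form k h x (w x))
    (pderiv (dual_form k h x (w x))
      + (\<Sum>m\<in>UNIV. \<Sum>is | length is = k.
          smult (partial_derivs (m # is) h x) ([:v $ m:] * prod_list (map (w x) is)))
      - (\<Sum>is | length is = k.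
          smult (partial_derivs is h x) (leibniz_sum (\<lambda>i. [:v $ i:]) (w x) is))) x"
proof -
  have *: "has_coeff_deriv r v (\<lambda>x. smult (partial_derivs is h x) (prod_list (map (w x) is)))
      (smult (\<Sum>m\<in>UNIV. v $ m * partial_derivs (m # is) h x) (prod_list (map (w x) is)) +
       smult (partial_derivs is h x) (leibniz_sum (\<lambda>i. pderiv (w x i) - [:v $ i:]) (w x) is)) x"
    if "length is = k" for "is"
  proof -
    have "times_cont_diff_on (Suc 0) S (partial_derivs is h)"
      using assms(2) that by (intro times_cont_diff_on_partial_derivs[OF assms(1)]) simp
    from times_cont_diff_on_has_derivative[OF this assms(3)]
    have d: "(partial_derivs is h has_derivative frechet_derivative (partial_derivs is h) (at x)) (at x)" .
    show ?thesis
      using has_coeff_deriv_smult[OF d has_coeff_deriv_prod_list[where w = "\<lambda>i x. w x i", OF assms(4)]]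
      unfolding has_derivative_eq_sum_partial_deriv[OF d] by simp
  qed
  have "(\<Sum>is | length is = k.
      smult (\<Sum>m\<in>UNIV. v $ m * partial_derivs (m # is) h x) (prod_list (map (w x) is)) +
      smult (partial_derivs is h x) (leibniz_sum (\<lambda>i. pderiv (w x i) - [:v $ i:]) (w x) is)) =
    pderiv (dual_form k h x (w x))
      + (\<Sum>m\<in>UNIV. \<Sum>is | length is = k.
          smult (partial_derivs (m # is) h x) ([:v $ m:] * prod_list (map (w x) is)))
      - (\<Sum>is | length is = k.
          smult (partial_derivs is h x) (leibniz_sum (\<lambda>i. [:v $ i:]) (w x) is))"
    unfolding dual_form_def
    by (subst sum.swap)
      (simp add: pderiv_sum pderiv_smult pderiv_prod_list leibniz_sum_diff smult_diff_right
        smult_sum sum.distrib sum_subtractf algebra_simps)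
  note eq = this
  have "has_coeff_deriv r v (\<lambda>x. \<Sum>is | length is = k.
      smult (partial_derivs is h x) (prod_list (map (w x) is)))
    (\<Sum>is | length is = k.
      smult (\<Sum>m\<in>UNIV. v $ m * partial_derivs (m # is) h x) (prod_list (map (w x) is)) +
      smult (partial_derivs is h x) (leibniz_sum (\<lambda>i. pderiv (w x i) - [:v $ i:]) (w x) is)) x"
    by (rule has_coeff_deriv_sum, rule *) simp
  then show ?thesis
    unfolding eq unfolding dual_form_def .
qed

text \<open>Differentiating the summand of order \<open>k\<close> through \<open>h\<close> cancels the constant part of the
  derivative of \<open>w\<close> in the summand of order \<open>Suc k\<close>.  The summand of order \<open>r\<close>
  itself need not be differentiable, but it is a multiple of \<open>\<epsilon>\<^sup>r\<close>.\<close>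

lemma has_coeff_deriv_taylor_poly:
  fixes h :: "real^'n \<Rightarrow> real"
  assumes "open S" "times_cont_diff_on r S h" "x \<in> S"
    and w: "\<And>x i. monom 1 1 dvd w x i"
    and w': "\<And>i. monom 1 1 dvd pderiv (w x i) - [:v $ i:]"
    and dw: "\<And>i. has_coeff_deriv r v (\<lambda>x. w x i) (pderiv (w x i) - [:v $ i:]) x"
  shows "has_coeff_deriv r v (\<lambda>x. taylor_poly r h x (w x)) (pderiv (taylor_poly r h x (w x))) x"
proof -
  \<comment> \<open>\<open>C k\<close> comes from differentiating the tensor of order
    \<open>k\<close>, and \<open>E k\<close> from the constant parts \<open>v\<close> in the
    derivatives of its factors.\<close>
  define C where "C k = (\<Sum>m\<in>UNIV. \<Sum>is | length is = k.
    smult (partial_derivs (m # is) h x) ([:v $ m:] * prod_list (map (w x) is)))" for k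
  define E where "E k = (\<Sum>is | length is = k.
    smult (partial_derivs is h x) (leibniz_sum (\<lambda>i. [:v $ i:]) (w x) is))" for k
  define A where "A k = (\<lambda>x. dual_form k h x (w x))" for k
  define Q where "Q = (\<Sum>k<r. smult (1 / fact k) (pderiv (A k x) + C k - E k))"
  \<comment> \<open>Symmetry of the tensor of order \<open>Suc k\<close> enters here; after division
    by factorials, \<open>C k\<close> cancels against \<open>E (Suc k)\<close>.\<close>
  have E_Suc: "E (Suc k) = of_nat (Suc k) * C k" if "k < r" for k
    unfolding E_def C_def using that
    by (intro sum_symmetric_leibniz_sum partial_derivs_swap[OF assms(1-3)]) auto
  \<comment> \<open>The sum telescopes; it starts from zero because \<open>E 0\<close> is an empty
    Leibniz sum.\<close>
  have "(\<Sum>k<n. smult (1 / fact k) (C k - E k)) = smult (1 / fact n) (E n)" if "n \<le> r" for n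
    using that
  proof (induction n)
    case 0
    then show ?case by (simp add: E_def)
  next
    case (Suc n)
    then show ?case
      by (simp add: E_Suc smult_diff_right of_nat_poly divide_simps del: of_nat_Suc)
  qed
  then have Q: "Q = (\<Sum>k<r. smult (1 / fact k) (pderiv (A k x))) + smult (1 / fact r) (E r)"
    by (simp add: Q_def smult_add_right smult_diff_right sum.distrib sum_subtractf algebra_simps)
  \<comment> \<open>The uncancelled \<open>E r\<close> stands in for the missing derivative of the
    top summand: by \<open>w'\<close> the two differ by a multiple of
    \<epsilon>^\<open>r\<close>.\<close>
  have "pderiv (A r x) - E r = (\<Sum>is | length is = r. smult (partial_derivs is h x)
      (leibniz_sum (\<lambda>i. pderiv (w x i) - [:v $ i:]) (w x) is))"
    by (simp add: A_def E_def dual_form_def pderiv_sum pderiv_smult pderiv_prod_list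
        leibniz_sum_diff smult_diff_right sum_subtractf)
  then have "monom 1 r dvd pderiv (A r x) - E r"
    using monom_dvd_leibniz_sum[of "w x", OF w w'] by (auto intro!: dvd_sum dvd_smult)
  then have "monom 1 r dvd smult (1 / fact r) (pderiv (A r x) - E r)"
    by (rule dvd_smult)
  moreover have "smult (1 / fact r) (pderiv (A r x) - E r) = pderiv (taylor_poly r h x (w x)) - Q"
    by (simp add: Q taylor_poly_def A_def pderiv_sum pderiv_smult pderiv_add lessThan_Suc_atMost[symmetric]
        smult_diff_right)
  ultimately have QP: "coeff Q j = coeff (pderiv (taylor_poly r h x (w x))) j" if "j < r" for j
    using that by (simp add: monom_1_dvd_iff')
  have A: "has_coeff_deriv r v (A k) (pderiv (A k x) + C k - E k) x" if "k < r" for k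
    unfolding A_def C_def E_def
    by (rule has_coeff_deriv_dual_form[OF assms(1) times_cont_diff_on_mono[OF assms(2)] assms(3) dw])
      (use that in simp)
  have "has_coeff_deriv r v (\<lambda>x. smult (1 / fact k) (A k x))
      (smult (1 / fact k) (pderiv (A k x) + C k - E k)) x" if "k < r" for k
    using has_coeff_deriv_smult[OF has_derivative_const[of "1 / fact k"] A[OF that]] by simp
  then have "has_coeff_deriv r v (\<lambda>x. \<Sum>k<r. smult (1 / fact k) (A k x)) Q x"
    unfolding Q_def by (intro has_coeff_deriv_sum) auto
  moreover have "has_coeff_deriv r v (\<lambda>x. smult (1 / fact r) (A r x)) 0 x"
    unfolding A_def by (intro has_coeff_deriv_0 dvd_smult monom_dvd_dual_form w)
  ultimately have "has_coeff_deriv r v (\<lambda>x. (\<Sum>k<r. smult (1 / fact k) (A k x)) +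
      smult (1 / fact r) (A r x)) (Q + 0) x"
    by (rule has_coeff_deriv_add)
  then have "has_coeff_deriv r v (\<lambda>x. taylor_poly r h x (w x)) Q x"
    by (simp add: taylor_poly_def A_def lessThan_Suc_atMost[symmetric])
  then show ?thesis
    unfolding has_coeff_deriv_def using QP by simp
qed

text \<open>Differentiating coefficient \<open>j\<close> along \<open>f\<close> gives
  \<open>Suc j\<close> times coefficient \<open>Suc j\<close>, which turns \<open>fact j\<close>
  into \<open>fact (Suc j)\<close>. The induction ranges over all points of \<open>S\<close>, since
  the identity itself gets differentiated.\<close>

lemma lie_deriv_eq_coeff_taylor_poly:
  fixes h :: "real^'n \<Rightarrow> real"
  assumes "r \<ge> 1" "open S" "times_cont_diff_on r S h" "times_cont_diff_on (r - 1) S f"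
    and "j \<le> r" "x \<in> S"
  shows "lie_deriv f j h x = fact j * coeff (taylor_poly r h x (seed_offset r f x)) j"
  using assms(5,6)
proof (induction j arbitrary: x)
  case 0
  then show ?case by (simp add: coeff_0_taylor_poly[OF monom_dvd_seed_offset])
next
  case (Suc j)
  let ?P = "\<lambda>x. taylor_poly r h x (seed_offset r f x)"
  have "has_coeff_deriv r (f x) ?P (pderiv (?P x)) x"
    using assms(1-4) Suc.prems
    by (intro has_coeff_deriv_taylor_poly monom_dvd_seed_offset monom_dvd_pderiv_seed_offset
        has_coeff_deriv_seed_offset)
  then obtain G where G: "((\<lambda>x. coeff (?P x) j) has_derivative G) (at x)"
      "G (f x) = coeff (pderiv (?P x)) j"
    using Suc.prems by (auto simp: has_coeff_deriv_def Suc_le_eq)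
  have "((\<lambda>x. fact j * coeff (?P x) j) has_derivative (\<lambda>v. fact j * G v)) (at x)"
    using G(1) by (rule has_derivative_mult_right)
  \<comment> \<open>The induction hypothesis holds throughout the open set \<open>S\<close>, so the
    derivative transfers to \<open>lie_deriv f j h\<close>.\<close>
  then have "(lie_deriv f j h has_derivative (\<lambda>v. fact j * G v)) (at x)"
    by (rule has_derivative_transform_within_open[OF _ assms(2) Suc.prems(2)])
      (use Suc in simp)
  from gradient_inner_eq_has_derivative[OF this] show ?case
    by (simp add: G(2) coeff_pderiv)
qed

theorem theorem6:
  fixes r :: nat
    and D :: "(real^'n) set"
    and h :: "real^'n \<Rightarrow> real"
    and f :: "real^'n \<Rightarrow> real^'n"
    and x :: "real^'n"
  assumes "r \<ge> 1"
    and "open D"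
    and "times_cont_diff_on r D h"
    and "local_lipschitz (UNIV :: real set) D (\<lambda>_. f)"
    and "times_cont_diff_on (r - 1) D f"
    and "x \<in> D"
  shows "dual_ext r h (dual_seed r f x) = (\<Sum>j\<le>r. monom (1 / fact j * lie_deriv f j h x) j)
    \<and> (\<forall>j\<in>{0..r}. lie_deriv f j h x = fact j * coeff (dual_ext r h (dual_seed r f x)) j)"
proof -
  \<comment> \<open>The seed has constant term \<open>x\<close>, so the Taylor expansion is taken at
    \<open>x\<close> in the argument \<open>seed_offset\<close>; truncation leaves coefficients up
    to \<open>r\<close> unchanged.\<close>
  have lie: "lie_deriv f j h x = fact j * coeff (dual_ext r h (dual_seed r f x)) j" if "j \<le> r" for j
    unfolding lie_deriv_eq_coeff_taylor_poly[OF assms(1-3,5) that assms(6)]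
    using that by (simp add: coeff_dual_ext dual_const_seed seed_offset_def[abs_def])
  have "coeff (dual_ext r h (dual_seed r f x)) j =
      coeff (\<Sum>j\<le>r. monom (1 / fact j * lie_deriv f j h x) j) j" for j
  proof (cases "j \<le> r")
    case True
    then show ?thesis
      using lie[OF True] by (simp add: coeff_sum)
  next
    case False
    then show ?thesis
      by (simp add: coeff_sum coeff_dual_ext)
  qed
  then have "dual_ext r h (dual_seed r f x) = (\<Sum>j\<le>r. monom (1 / fact j * lie_deriv f j h x) j)"
    by (rule poly_eqI)
  moreover have "\<forall>j\<in>{0..r}. lie_deriv f j h x = fact j * coeff (dual_ext r h (dual_seed r f x)) j"
    by (intro ballI lie) simp
  ultimately show ?thesis ..
qed

end
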